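(* Let $N,K\ge 1$, let $\lambda=(\lambda_1,\dots,\lambda_K)\in\Sigma_K$, i.e. $\lambda_k\ge 0$ for all $k$ and $\sum_{k=1}^K\lambda_k=1$, and let $\bar{\boldsymbol\gamma}=(\bar\gamma_k)_{k=1}^K$ be a family of $N\times N$ matrices with strictly positive entries. Let $$\mathcal C_2=\{\boldsymbol\gamma=(\gamma_k)_{k=1}^K\in(\mathbb R_+^{N\times N})^K : \exists\, p\in\mathbb R^N,\ \forall k,\ \gamma_k\mathbf 1=p\}.$$ Then the projection $\boldsymbol\gamma=(\gamma_k)_{k=1}^K=P^{\mathrm{KL}_\lambda}_{\mathcal C_2}(\bar{\boldsymbol\gamma})=\operatorname{argmin}_{\boldsymbol\gamma\in\mathcal C_2}\mathrm{KL}_\lambda(\boldsymbol\gamma|\bar{\boldsymbol\gamma})$ satisfies $$\forall k\in\{1,\dots,K\},\qquad \gamma_k=\operatorname{diag}\!\left(\frac{p}{\bar\gamma_k\mathbf 1}\right)\bar\gamma_k,\qquad\text{where } p=\prod_{r=1}^K(\bar\gamma_r\mathbf 1)^{\lambda_r},$$ the product, powers and quotient of vectors being entry-wise.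
   Context: $\mathbf 1\in\mathbb R^N$ is the all-ones vector; $\mathbb R_+=[0,\infty)$; $\Sigma_K=\{\lambda\in\mathbb R_+^K:\sum_k\lambda_k=1\}$ is the simplex. For $\gamma\in\mathbb R_+^{N\times N}$ and $\xi\in\mathbb R^{N\times N}$ with strictly positive entries, the Kullback-Leibler divergence is $$\mathrm{KL}(\gamma|\xi)=\sum_{i,j=1}^N\gamma_{i,j}\left(\log\frac{\gamma_{i,j}}{\xi_{i,j}}-1\right),$$ with the convention $0\log 0=0$. For families $\boldsymbol\gamma=(\gamma_k)_{k=1}^K$ and $\boldsymbol\xi=(\xi_k)_{k=1}^K$ of such matrices, $\mathrm{KL}_\lambda(\boldsymbol\gamma|\boldsymbol\xi)=\sum_{k=1}^K\lambda_k\,\mathrm{KL}(\gamma_k|\xi_k)$.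
   Formalization: If some λ_k = 0 the argmin need not be unique, so the formal claim is: the family given by the formula is a minimizer; every minimizer satisfies the formula at each k with λ_k > 0; and if all λ_k > 0 it is the unique minimizer. *)

theory Defs
  imports "HOL-Analysis.Analysis"
begin

text \<open>
  The dimensions N and K are the cardinalities of the index types \<open>'n\<close> and \<open>'k\<close>, hence at least 1.
\<close>

definition prob_simplex :: "(real ^ 'k) set" where
  "prob_simplex = {l. (\<forall>k. 0 \<le> l $ k) \<and> (\<Sum>k\<in>UNIV. l $ k) = 1}"

text \<open>
  The convention \<open>0 log 0 = 0\<close> holds here automatically: \<open>ln 0\<close> is a real number in HOL, so the
  summand of a zero entry of \<open>G\<close> is 0.
\<close>

definition KL :: "real ^ 'n ^ 'n \<Rightarrow> real ^ 'n ^ 'n \<Rightarrow> real" where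
  "KL G X = (\<Sum>i\<in>UNIV. \<Sum>j\<in>UNIV. G $ i $ j * (ln (G $ i $ j / X $ i $ j) - 1))"

definition KL_weighted ::
    "real ^ 'k \<Rightarrow> ('k \<Rightarrow> real ^ 'n ^ 'n) \<Rightarrow> ('k \<Rightarrow> real ^ 'n ^ 'n) \<Rightarrow> real" where
  "KL_weighted l G X = (\<Sum>k\<in>UNIV. l $ k * KL (G k) (X k))"

text \<open>
  The set of all minimizers. It need not be a singleton: \<open>KL_weighted l G X\<close> does not depend on
  \<open>G k\<close> when \<open>l $ k = 0\<close>.
\<close>

definition KL_projections ::
    "real ^ 'k \<Rightarrow> ('k \<Rightarrow> real ^ 'n ^ 'n) set \<Rightarrow> ('k \<Rightarrow> real ^ 'n ^ 'n) \<Rightarrow> ('k \<Rightarrow> real ^ 'n ^ 'n) set" where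
  "KL_projections l C X = {G. is_arg_min (\<lambda>H. KL_weighted l H X) (\<lambda>H. H \<in> C) G}"

definition C2 :: "('k \<Rightarrow> real ^ 'n ^ 'n) set" where
  "C2 = {G. (\<forall>k i j. 0 \<le> G k $ i $ j) \<and> (\<exists>p. \<forall>k. G k *v 1 = p)}"

definition diag :: "real ^ 'n \<Rightarrow> real ^ 'n ^ 'n" where
  "diag v = (\<chi> i j. if i = j then v $ i else 0)"

end

theory Submission
  imports Defs
begin

text \<open>
  Write \<open>s\<^sub>k\<close> for the row sums of \<open>Gbar k\<close>. On \<open>C2\<close>, replacing the reference family \<open>Gbar\<close> by \<open>F\<close>
  does not change the weighted divergence: \<open>F k $ i $ j / Gbar k $ i $ j = p\<^sub>i / s\<^sub>k\<^sub>i\<close> does not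
  depend on \<open>j\<close>, so the difference at row \<open>i\<close> is the common row sum of the \<open>G k\<close> times
  \<open>\<Sum>k. l\<^sub>k (ln p\<^sub>i - ln s\<^sub>k\<^sub>i)\<close>, which vanishes because \<open>p\<close> is the weighted geometric mean of
  the \<open>s\<^sub>k\<close>. Relative to \<open>F\<close>, Gibbs' inequality says that \<open>F\<close> itself is the minimizer.
\<close>

text \<open>Gibbs' inequality for one entry: \<open>ln x \<le> x - 1\<close> at
  \<open>x = b / a\<close>, multiplied by \<open>a\<close>. For \<open>a = 0\<close> the right-hand
  side is 0.\<close>

lemma mult_ln_div_minus_one_ge:
  fixes a b :: real
  assumes "0 \<le> a" "0 < b"
  shows "- b \<le> a * (ln (a / b) - 1)"
proof (cases "a = 0")
  case False
  with assms have "0 < a" by simp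
  then have "a * ln (b / a) \<le> a * (b / a - 1)"
    using assms by (intro mult_left_mono ln_le_minus_one) auto
  with \<open>0 < a\<close> assms show ?thesis
    by (simp add: ln_div algebra_simps)
qed (use assms in simp)

text \<open>Equality in \<open>ln x \<le> x - 1\<close> holds only at \<open>x = 1\<close>;
  \<open>a = 0\<close> is excluded, as it would give \<open>b = 0\<close>.\<close>

lemma mult_ln_div_minus_one_eqD:
  fixes a b :: real
  assumes "0 \<le> a" "0 < b" "a * (ln (a / b) - 1) = - b"
  shows "a = b"
proof -
  have "0 < a" using assms by (cases "a = 0") auto
  then have "a * ln (b / a) = a * (b / a - 1)"
    using assms by (simp add: ln_div algebra_simps)
  with \<open>0 < a\<close> have "ln (b / a) = b / a - 1" by simp
  with \<open>0 < a\<close> assms have "b / a = 1" by (intro ln_eq_minus_one) auto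
  with \<open>0 < a\<close> show ?thesis by simp
qed

lemma KL_self:
  assumes "\<And>i j. 0 < X $ i $ j"
  shows "KL X X = - (\<Sum>i\<in>UNIV. \<Sum>j\<in>UNIV. X $ i $ j)"
  unfolding KL_def using assms[THEN less_imp_neq] by (simp add: sum_negf)

lemma KL_self_le:
  assumes "\<And>i j. 0 \<le> G $ i $ j" "\<And>i j. 0 < X $ i $ j"
  shows "KL X X \<le> KL G X"
  unfolding KL_self[OF assms(2)] unfolding KL_def sum_negf[symmetric]
  by (intro sum_mono mult_ln_div_minus_one_ge assms)

lemma KL_eq_self_imp_eq:
  assumes "\<And>i j. 0 \<le> G $ i $ j" "\<And>i j. 0 < X $ i $ j" "KL G X = KL X X"
  shows "G = X"
proof -
  \<comment> \<open>The \<open>?d i j\<close> add up to \<open>KL G X - KL X X\<close>, so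
    nonnegative terms with total 0 must all vanish.\<close>
  let ?d = "\<lambda>i j. G $ i $ j * (ln (G $ i $ j / X $ i $ j) - 1) + X $ i $ j"
  have nonneg: "0 \<le> ?d i j" for i j
    using mult_ln_div_minus_one_ge[of "G $ i $ j" "X $ i $ j"] assms(1,2) by simp
  have "(\<Sum>i\<in>UNIV. \<Sum>j\<in>UNIV. ?d i j) = 0"
    using assms(3) unfolding KL_self[OF assms(2)] by (simp add: KL_def sum.distrib)
  then have "?d i j = 0" for i j
    using nonneg by (simp add: sum_nonneg_eq_0_iff sum_nonneg)
  then have "G $ i $ j = X $ i $ j" for i j
    using mult_ln_div_minus_one_eqD[OF assms(1,2)] eq_neg_iff_add_eq_0 by blast
  then show ?thesis by (simp add: vec_eq_iff)
qed

lemma matrix_vector_mult_one: "(A *v 1) $ i = (\<Sum>j\<in>UNIV. A $ i $ j)"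
  for A :: "real ^ 'n ^ 'm"
  by (simp add: matrix_vector_mult_def)

lemma diag_mult_nth: "(diag v ** A) $ i $ j = v $ i * A $ i $ j"
  by (simp add: diag_def matrix_matrix_mult_def if_distrib[of "\<lambda>x. x * _"] cong: if_cong)

text \<open>Scaling row \<open>i\<close> of the reference shifts every logarithm in that row by the
  constant \<open>ln (v $ i)\<close>, so the correction sees \<open>G\<close> only through its row
  sums.\<close>

lemma KL_diag_mult:
  assumes "\<And>i j. 0 \<le> G $ i $ j" "\<And>i j. 0 < X $ i $ j" "\<And>i. 0 < v $ i"
  shows "KL G X = KL G (diag v ** X) + (\<Sum>i\<in>UNIV. (G *v 1) $ i * ln (v $ i))"
proof -
  have "G $ i $ j * (ln (G $ i $ j / X $ i $ j) - 1) =
      G $ i $ j * (ln (G $ i $ j / (v $ i * X $ i $ j)) - 1) + G $ i $ j * ln (v $ i)" for i j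
  proof (cases "G $ i $ j = 0")
    case False
    with assms(1)[of i j] have "0 < G $ i $ j" by simp
    with assms(2)[of i j] assms(3)[of i] show ?thesis
      by (simp add: ln_div ln_mult algebra_simps)
  qed simp
  then show ?thesis
    by (simp add: KL_def diag_mult_nth matrix_vector_mult_one sum.distrib sum_distrib_right)
qed

text \<open>Uniqueness can fail when a weight is zero, since that component is then restricted only
  by membership in \<open>C2\<close>; hence the separate claims on existence, on components of
  positive weight, and on a singleton argmin.\<close>

theorem proposition2:
  fixes l :: "real ^ 'k" and Gbar :: "'k \<Rightarrow> real ^ 'n ^ 'n"
    and p :: "real ^ 'n" and F :: "'k \<Rightarrow> real ^ 'n ^ 'n"
  assumes "l \<in> prob_simplex"
    and "\<And>k i j. 0 < Gbar k $ i $ j"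
    and "p = (\<chi> i. \<Prod>r\<in>UNIV. ((Gbar r *v 1) $ i) powr (l $ r))"
    and "\<And>k. F k = diag (\<chi> i. p $ i / (Gbar k *v 1) $ i) ** Gbar k"
  shows "F \<in> KL_projections l C2 Gbar \<and>
    (\<forall>G \<in> KL_projections l C2 Gbar. \<forall>k. 0 < l $ k \<longrightarrow> G k = F k) \<and>
    ((\<forall>k. 0 < l $ k) \<longrightarrow> KL_projections l C2 Gbar = {F})"
proof -
  have l_nonneg: "\<And>k. 0 \<le> l $ k" and l_sum: "(\<Sum>k\<in>UNIV. l $ k) = 1"
    using assms(1) by (auto simp: prob_simplex_def)
  define s where "s k i = (Gbar k *v 1) $ i" for k i
  have s_pos: "0 < s k i" for k i
    unfolding s_def matrix_vector_mult_one by (intro sum_pos assms(2)) auto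
  have s_nz: "s k i \<noteq> 0" for k i
    using s_pos[of k i] by simp
  have p_eq: "p $ i = (\<Prod>r\<in>UNIV. s r i powr (l $ r))" for i
    by (simp add: assms(3) s_def)
  have p_pos: "0 < p $ i" for i
    unfolding p_eq by (intro prod_pos) (simp add: s_nz)
  have ln_p: "ln (p $ i) = (\<Sum>r\<in>UNIV. l $ r * ln (s r i))" for i
    unfolding p_eq by (subst ln_prod) (auto simp: s_nz ln_powr)
  have F_eq: "F k $ i $ j = p $ i / s k i * Gbar k $ i $ j" for k i j
    by (simp add: assms(4) diag_mult_nth s_def)
  have F_pos: "0 < F k $ i $ j" for k i j
    by (simp add: F_eq p_pos s_pos assms(2))
  have "F k *v 1 = p" for k
  proof -
    have "(F k *v 1) $ i = p $ i / s k i * s k i" for i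
      unfolding matrix_vector_mult_one F_eq sum_distrib_left[symmetric]
      by (simp add: s_def matrix_vector_mult_one)
    then show ?thesis by (simp add: vec_eq_iff s_nz)
  qed
  then have F_C2: "F \<in> C2"
    using F_pos by (auto simp: C2_def less_imp_le)

  have change_reference: "KL_weighted l G Gbar = KL_weighted l G F" if G: "G \<in> C2" for G
  proof -
    from G obtain q where q: "\<And>k. G k *v 1 = q" by (auto simp: C2_def)
    have log_mean: "(\<Sum>k\<in>UNIV. l $ k * ln (p $ i / s k i)) = 0" for i
    proof -
      have "(\<Sum>k\<in>UNIV. l $ k * ln (p $ i / s k i)) =
          (\<Sum>k\<in>UNIV. l $ k) * ln (p $ i) - (\<Sum>k\<in>UNIV. l $ k * ln (s k i))"
        using p_pos[of i]
        by (simp add: ln_div s_nz right_diff_distrib sum_subtractf sum_distrib_right)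
      then show ?thesis by (simp add: l_sum ln_p)
    qed
    \<comment> \<open>All components share the row sums \<open>q\<close>, so after weighting by
      \<open>l\<close> the sum over \<open>k\<close> acts on the logarithms alone and
      \<open>log_mean\<close> applies.\<close>
    have "KL (G k) (Gbar k) = KL (G k) (F k) + (\<Sum>i\<in>UNIV. q $ i * ln (p $ i / s k i))" for k
      unfolding assms(4) using G p_pos s_pos assms(2)
      by (subst KL_diag_mult[where v = "\<chi> i. p $ i / s k i"]) (auto simp: C2_def q s_def)
    then have "KL_weighted l G Gbar = KL_weighted l G F +
        (\<Sum>k\<in>UNIV. \<Sum>i\<in>UNIV. q $ i * (l $ k * ln (p $ i / s k i)))"
      by (simp add: KL_weighted_def distrib_left sum.distrib sum_distrib_left mult_ac)
    also have "(\<Sum>k\<in>UNIV. \<Sum>i\<in>UNIV. q $ i * (l $ k * ln (p $ i / s k i))) =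
        (\<Sum>i\<in>UNIV. q $ i * (\<Sum>k\<in>UNIV. l $ k * ln (p $ i / s k i)))"
      by (subst sum.swap) (simp add: sum_distrib_left)
    finally show ?thesis by (simp add: log_mean)
  qed

  have term_le: "l $ k * KL (F k) (F k) \<le> l $ k * KL (G k) (F k)" if "G \<in> C2" for G k
    using that F_pos l_nonneg by (intro mult_left_mono KL_self_le) (auto simp: C2_def)
  have F_min: "KL_weighted l F Gbar \<le> KL_weighted l G Gbar" if "G \<in> C2" for G
    unfolding change_reference[OF that] change_reference[OF F_C2] unfolding KL_weighted_def
    by (intro sum_mono term_le that)
  then have F_proj: "F \<in> KL_projections l C2 Gbar"
    using F_C2 by (auto simp: KL_projections_def is_arg_min_linorder)

  have unique: "G k = F k" if G: "G \<in> KL_projections l C2 Gbar" and k: "0 < l $ k" for G k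
  proof -
    from G have G_C2: "G \<in> C2" and "KL_weighted l G Gbar \<le> KL_weighted l F Gbar"
      using F_C2 by (auto simp: KL_projections_def is_arg_min_linorder)
    with F_min[OF G_C2] have "KL_weighted l F F = KL_weighted l G F"
      by (simp add: change_reference F_C2)
    \<comment> \<open>By \<open>term_le\<close> each summand for \<open>F\<close> is at most the one
      for \<open>G\<close>; equal totals therefore force equality in every summand.\<close>
    then have "l $ k * KL (F k) (F k) = l $ k * KL (G k) (F k)"
      unfolding KL_weighted_def
      by (rule sum_mono_inv) (use term_le[OF G_C2] in auto)
    with k have "KL (G k) (F k) = KL (F k) (F k)" by simp
    moreover from G_C2 have "0 \<le> G k $ i $ j" for i j
      by (simp add: C2_def)
    ultimately show ?thesis
      using F_pos by (intro KL_eq_self_imp_eq)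
  qed
  then have "KL_projections l C2 Gbar = {F}" if "\<forall>k. 0 < l $ k"
    using that F_proj by (auto intro!: ext)
  with F_proj unique show ?thesis by simp
qed

end
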